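(* For a fixed $k\in(0,1)$, the set $A_k=\{\psi_\alpha:\alpha\in(-\tfrac12\pi,\tfrac12\pi]\}$ of self-maps of the unit circle $T$ is a commutative group under composition. Its identity element is $\psi_0$, and the inverse of an element $\psi_\alpha$ is $\psi_{-\alpha}$. In particular, $\psi_{\pi/2}$ is its own inverse, and it is the only non-degenerate (i.e. non-identity) involution of $T$ in the group $A_k$.
   Context: $T$ is the unit circle in $\mathbb C$. Let $g(\theta)=g(\theta;k)=\int_0^\theta \frac{dt}{\sqrt{1-k^2\sin^2 t}}$ for $\theta\in\mathbb R$; it is a strictly increasing bijection $\mathbb R\to\mathbb R$ with inverse denoted $\mathrm{am}$. For $\alpha\in\mathbb R$, the map $\psi_\alpha:T\to T$ is defined as follows: for $z\in T$ write $z=e^{2i\theta}$ with $\theta\in\mathbb R$, put $u=g(\theta)$, $a=g(\alpha)$, let $\theta'=\mathrm{am}(u+a)$ (i.e. $g(\theta')=u+a$), and set $\psi_\alpha(z)=e^{2i\theta'}$. This does not depend on the choice of $\theta$. *)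

theory Defs
  imports "HOL-Analysis.Analysis" "HOL-Algebra.Group"
begin

abbreviation unit_circle :: "complex set" where
  "unit_circle \<equiv> sphere 0 1"

text \<open>The interval integral is oriented, so for \<open>\<theta> < 0\<close> it is minus the integral over
  \<open>[\<theta>, 0]\<close>.\<close>

definition ell :: "real \<Rightarrow> real \<Rightarrow> real" where
  "ell k \<theta> = (LBINT t=0..\<theta>. 1 / sqrt (1 - k\<^sup>2 * (sin t)\<^sup>2))"

definition am :: "real \<Rightarrow> real \<Rightarrow> real" where
  "am k = inv_into UNIV (ell k)"

text \<open>Self-maps of the circle are extensional functions, i.e. \<open>undefined\<close> off the circle, so
  that equality of functions is equality of maps on the circle. The choice of \<open>\<theta>\<close> is
  irrelevant by \<open>psi_cis\<close> below.\<close>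

definition psi :: "real \<Rightarrow> real \<Rightarrow> complex \<Rightarrow> complex" where
  "psi k \<alpha> = (\<lambda>z\<in>unit_circle.
     let \<theta> = (SOME \<theta>. z = cis (2 * \<theta>)) in cis (2 * am k (ell k \<theta> + ell k \<alpha>)))"

definition psi_maps :: "real \<Rightarrow> (complex \<Rightarrow> complex) set" where
  "psi_maps k = psi k ` {- pi / 2 <.. pi / 2}"

definition psi_group :: "real \<Rightarrow> (complex \<Rightarrow> complex) monoid" where
  "psi_group k = \<lparr>carrier = psi_maps k, mult = compose unit_circle, one = (\<lambda>z\<in>unit_circle. z)\<rparr>"

lemma psi_self_map: "psi k \<alpha> \<in> unit_circle \<rightarrow>\<^sub>E unit_circle"
  by (auto simp: psi_def Let_def)

lemma ell_integrand_ge_1: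
  fixes k :: real
  assumes "0 < k" "k < 1"
  shows "0 < 1 - k\<^sup>2 * (sin t)\<^sup>2" "1 \<le> 1 / sqrt (1 - k\<^sup>2 * (sin t)\<^sup>2)"
proof -
  have "k\<^sup>2 < 1" using assms by (simp add: power_less_one_iff)
  moreover have s: "(sin t)\<^sup>2 \<le> 1" by (simp add: abs_square_le_1)
  ultimately have "k\<^sup>2 * (sin t)\<^sup>2 \<le> k\<^sup>2 * 1" by (intro mult_left_mono) auto
  then show p: "0 < 1 - k\<^sup>2 * (sin t)\<^sup>2" using \<open>k\<^sup>2 < 1\<close> by linarith
  have "sqrt (1 - k\<^sup>2 * (sin t)\<^sup>2) \<le> 1" by simp
  then show "1 \<le> 1 / sqrt (1 - k\<^sup>2 * (sin t)\<^sup>2)" using p by simp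
qed

lemma ell_has_real_derivative:
  fixes k :: real
  assumes "0 < k" "k < 1"
  shows "(ell k has_real_derivative 1 / sqrt (1 - k\<^sup>2 * (sin x)\<^sup>2)) (at x)"
proof -
  let ?f = "\<lambda>t. 1 / sqrt (1 - k\<^sup>2 * (sin t)\<^sup>2)"
  let ?a = "min x 0 - 1" and ?b = "max x 0 + 1"
  have cont: "continuous_on {?a..?b} ?f"
    using ell_integrand_ge_1(1)[OF assms] by (intro continuous_intros) (auto simp: less_le)
  have "((\<lambda>u. LBINT t=0..u. ?f t) has_vector_derivative ?f x) (at x within {?a..?b})"
    using interval_integral_FTC2[of ?a 0 ?b ?f x] cont by (simp add: zero_ereal_def)
  moreover have "at x within {?a..?b} = at x"
    by (rule at_within_interior) auto
  ultimately have "((\<lambda>u. LBINT t=0..u. ?f t) has_vector_derivative ?f x) (at x)"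
    by simp
  then show ?thesis
    by (simp add: has_real_derivative_iff_has_vector_derivative ell_def[abs_def])
qed

lemma ell_0 [simp]: "ell k 0 = 0"
  by (simp add: ell_def zero_ereal_def)

lemma ell_diff_ge:
  fixes k :: real
  assumes "0 < k" "k < 1" "x \<le> y"
  shows "y - x \<le> ell k y - ell k x"
proof -
  have "ell k x - x \<le> ell k y - y"
  proof (rule DERIV_nonneg_imp_nondecreasing[OF assms(3)])
    fix t
    have "((\<lambda>x. ell k x - x) has_real_derivative 1 / sqrt (1 - k\<^sup>2 * (sin t)\<^sup>2) - 1) (at t)"
      by (intro derivative_intros ell_has_real_derivative assms)
    then show "\<exists>d. ((\<lambda>x. ell k x - x) has_real_derivative d) (at t) \<and> 0 \<le> d"
      using ell_integrand_ge_1(2)[OF assms(1,2), of t] by (intro exI conjI) auto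
  qed
  then show ?thesis by simp
qed

lemma ell_strict_mono:
  assumes "0 < k" "k < 1"
  shows "strict_mono (ell k)"
proof (rule strict_monoI)
  fix x y :: real
  assume "x < y"
  then show "ell k x < ell k y" using ell_diff_ge[OF assms, of x y] by simp
qed

lemma ell_bij:
  assumes "0 < k" "k < 1"
  shows "bij (ell k)"
proof (rule bijI)
  show "inj (ell k)" by (rule strict_mono_imp_inj_on[OF ell_strict_mono[OF assms]])
  show "surj (ell k)"
    unfolding surj_def
  proof
    fix y
    have "\<exists>x. - \<bar>y\<bar> \<le> x \<and> x \<le> \<bar>y\<bar> \<and> ell k x = y"
    proof (rule IVT')
      show "ell k (- \<bar>y\<bar>) \<le> y" using ell_diff_ge[OF assms, of "- \<bar>y\<bar>" 0] by simp
      show "y \<le> ell k \<bar>y\<bar>" using ell_diff_ge[OF assms, of 0 "\<bar>y\<bar>"] by simp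
      show "continuous_on {- \<bar>y\<bar>..\<bar>y\<bar>} (ell k)"
        by (rule DERIV_continuous_on)
          (rule DERIV_subset[OF ell_has_real_derivative[OF assms] subset_UNIV])
    qed auto
    then show "\<exists>x. y = ell k x" by blast
  qed
qed

lemma ell_add_pi:
  assumes "0 < k" "k < 1"
  shows "ell k (x + pi) = ell k x + ell k pi"
proof -
  have "((\<lambda>x. ell k (x + pi) - ell k x) has_real_derivative 0) (at t)" for t
  proof -
    have "((\<lambda>x. ell k (x + pi)) has_real_derivative
        1 / sqrt (1 - k\<^sup>2 * (sin (t + pi))\<^sup>2)) (at t)"
      using ell_has_real_derivative[OF assms, of "t + pi"] by (simp only: DERIV_shift)
    from DERIV_diff[OF this ell_has_real_derivative[OF assms, of t]] show ?thesis by simp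
  qed
  then have "\<forall>t. ((\<lambda>x. ell k (x + pi) - ell k x) has_real_derivative 0) (at t)"
    by (rule allI)
  from DERIV_isconst_all[OF this, of x 0] have "ell k (x + pi) - ell k x = ell k pi"
    by (simp only: add_0 ell_0 diff_0_right)
  then show ?thesis by linarith
qed

lemma ell_add_nat_pi:
  assumes "0 < k" "k < 1"
  shows "ell k (x + of_nat n * pi) = ell k x + of_nat n * ell k pi"
proof (induction n)
  case (Suc n)
  have "ell k (x + of_nat (Suc n) * pi) = ell k ((x + of_nat n * pi) + pi)"
    by (simp add: algebra_simps)
  then show ?case by (simp only: ell_add_pi[OF assms] Suc.IH) (simp add: algebra_simps)
qed simp

lemma ell_add_int_pi:
  assumes "0 < k" "k < 1"
  shows "ell k (x + of_int n * pi) = ell k x + of_int n * ell k pi"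
proof (cases n)
  case (nonneg m)
  then show ?thesis using ell_add_nat_pi[OF assms, of x m] by simp
next
  case (neg m)
  have "ell k (x + of_int n * pi + of_nat (Suc m) * pi) = ell k x"
    by (simp add: neg algebra_simps)
  then show ?thesis
    unfolding ell_add_nat_pi[OF assms] by (simp add: neg algebra_simps)
qed

lemma psi_cis:
  assumes "0 < k" "k < 1"
  shows "psi k \<alpha> (cis (2 * \<theta>)) = cis (2 * am k (ell k \<theta> + ell k \<alpha>))"
proof -
  define \<eta> where "\<eta> = (SOME \<eta>. cis (2 * \<theta>) = cis (2 * \<eta>))"
  have "cis (2 * \<theta>) = cis (2 * \<eta>)" unfolding \<eta>_def by (rule someI) (rule refl)
  then have "sin (2 * \<theta>) = sin (2 * \<eta>) \<and> cos (2 * \<theta>) = cos (2 * \<eta>)"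
    by (simp add: complex_eq_iff)
  then obtain n :: int where "2 * \<theta> = 2 * \<eta> + 2 * pi * n" by (metis sin_cos_eq_iff)
  then have \<theta>: "\<theta> = \<eta> + of_int n * pi" by (simp add: algebra_simps)
  have shift: "am k (u + of_int n * ell k pi) = am k u + of_int n * pi" for u
  proof -
    have "ell k (am k u + of_int n * pi) = u + of_int n * ell k pi"
      by (simp add: ell_add_int_pi[OF assms] am_def surj_f_inv_f[OF bij_is_surj[OF ell_bij[OF assms]]])
    then show ?thesis
      unfolding am_def by (rule inv_f_eq[OF bij_is_inj[OF ell_bij[OF assms]]])
  qed
  have "ell k \<theta> + ell k \<alpha> = (ell k \<eta> + ell k \<alpha>) + of_int n * ell k pi"
    by (simp add: \<theta> ell_add_int_pi[OF assms])
  then have "2 * am k (ell k \<theta> + ell k \<alpha>) = 2 * am k (ell k \<eta> + ell k \<alpha>) + 2 * pi * of_int n"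
    by (simp only: shift) (simp add: algebra_simps)
  then have "cis (2 * am k (ell k \<theta> + ell k \<alpha>)) = cis (2 * am k (ell k \<eta> + ell k \<alpha>))"
    by (simp add: cis_mult[symmetric])
  then show ?thesis by (simp add: psi_def Let_def \<eta>_def)
qed

end

theory Submission
  imports Defs
begin

text \<open>In the coordinate \<open>u = ell k \<theta>\<close> the map \<open>psi k \<alpha>\<close> is the translation by \<open>ell k \<alpha>\<close>, and
  \<open>ell k\<close> carries the period \<open>pi\<close> to the period \<open>ell k pi\<close>. So the maps form a copy of the group
  of reals modulo \<open>ell k pi\<close>, whose only element of order 2 is the class of
  \<open>ell k pi / 2 = ell k (pi / 2)\<close>.\<close>

lemma ell_am [simp]:
  assumes "0 < k" "k < 1"
  shows "ell k (am k u) = u"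
  unfolding am_def by (rule surj_f_inv_f[OF bij_is_surj[OF ell_bij[OF assms]]])

lemma am_ell [simp]:
  assumes "0 < k" "k < 1"
  shows "am k (ell k x) = x"
  unfolding am_def by (rule inv_f_f[OF bij_is_inj[OF ell_bij[OF assms]]])

lemma ell_eq_iff:
  assumes "0 < k" "k < 1"
  shows "ell k x = ell k y \<longleftrightarrow> x = y"
  using strict_mono_eq[OF ell_strict_mono[OF assms]] .

text \<open>The integrand is even, so the sum \<open>ell k (- x) + ell k x\<close> has derivative
  zero everywhere; it vanishes at \<open>0\<close>.\<close>

lemma ell_minus:
  assumes "0 < k" "k < 1"
  shows "ell k (- x) = - ell k x"
proof -
  have "((\<lambda>x. ell k (- x) + ell k x) has_real_derivative 0) (at t)" for t
  proof -
    have "((\<lambda>x. ell k (- x)) has_real_derivative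
        1 / sqrt (1 - k\<^sup>2 * (sin (- t))\<^sup>2) * (- 1)) (at t)"
      by (rule DERIV_chain2[OF ell_has_real_derivative[OF assms]]) (auto intro!: derivative_eq_intros)
    from DERIV_add[OF this ell_has_real_derivative[OF assms, of t]] show ?thesis by simp
  qed
  then have "\<forall>t. ((\<lambda>x. ell k (- x) + ell k x) has_real_derivative 0) (at t)"
    by (rule allI)
  from DERIV_isconst_all[OF this, of x 0] show ?thesis by simp
qed

lemma ell_int_pi:
  assumes "0 < k" "k < 1"
  shows "ell k (of_int n * pi) = of_int n * ell k pi"
  using ell_add_int_pi[OF assms, of 0 n] by simp

text \<open>The reflection that sends x to \<open>of_int n * pi - x\<close> fixes
  \<open>of_int n * (pi / 2)\<close>; oddness and quasi-periodicity of \<open>ell k\<close> then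
  determine the value there. For n = 1 this makes \<open>ell k (pi / 2)\<close> half of the period
  \<open>ell k pi\<close>.\<close>

lemma ell_int_half_pi:
  assumes "0 < k" "k < 1"
  shows "2 * ell k (of_int n * (pi / 2)) = of_int n * ell k pi"
proof -
  let ?x = "of_int n * (pi / 2)"
  have "ell k (- ?x + of_int n * pi) = ell k (- ?x) + of_int n * ell k pi"
    by (rule ell_add_int_pi[OF assms])
  moreover have "- ?x + of_int n * pi = ?x" by simp
  ultimately have "ell k ?x = - ell k ?x + of_int n * ell k pi"
    by (simp only: ell_minus[OF assms])
  then show ?thesis by linarith
qed

lemma unit_circle_cis:
  assumes "z \<in> unit_circle"
  obtains \<theta> where "z = cis (2 * \<theta>)"
proof
  show "z = cis (2 * (Arg z / 2))"
    using assms rcis_cmod_Arg[of z] by (simp add: rcis_def)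
qed

lemma cis_double_eq_iff: "cis (2 * x) = cis (2 * y) \<longleftrightarrow> (\<exists>n::int. x = y + of_int n * pi)"
proof -
  have "cis (2 * x) = cis (2 * y) \<longleftrightarrow> sin (2 * x) = sin (2 * y) \<and> cos (2 * x) = cos (2 * y)"
    by (auto simp: complex_eq_iff)
  also have "\<dots> \<longleftrightarrow> (\<exists>n::int. 2 * x = 2 * y + 2 * pi * of_int n)"
    by (rule sin_cos_eq_iff)
  also have "\<dots> \<longleftrightarrow> (\<exists>n::int. x = y + of_int n * pi)"
    by (intro ex_cong1) (auto simp: algebra_simps)
  finally show ?thesis .
qed

text \<open>Reduces equality of maps to arguments of the form \<open>cis (2 * \<theta>)\<close>, on
  which \<open>psi_cis\<close> evaluates \<open>psi\<close>.\<close>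

lemma extensional_unit_circle_eqI:
  assumes "f \<in> extensional unit_circle" "g \<in> extensional unit_circle"
    and "\<And>\<theta>. f (cis (2 * \<theta>)) = g (cis (2 * \<theta>))"
  shows "f = g"
  by (rule extensionalityI[OF assms(1,2)]) (metis assms(3) unit_circle_cis)

lemma psi_extensional: "psi k \<alpha> \<in> extensional unit_circle"
  by (simp add: psi_def)

lemma psi_0:
  assumes "0 < k" "k < 1"
  shows "psi k 0 = (\<lambda>z\<in>unit_circle. z)"
  by (rule extensional_unit_circle_eqI) (simp_all add: psi_extensional psi_cis assms)

text \<open>Translations add. The resulting index may leave the interval used in
  \<open>psi_maps\<close>; \<open>psi_maps_eq_range\<close> takes care of that.\<close>

lemma compose_psi:
  assumes "0 < k" "k < 1"
  shows "compose unit_circle (psi k \<alpha>) (psi k \<beta>) = psi k (am k (ell k \<alpha> + ell k \<beta>))"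
  by (rule extensional_unit_circle_eqI)
    (simp_all add: psi_extensional psi_cis compose_def assms add_ac)

lemma psi_eq_iff:
  assumes "0 < k" "k < 1"
  shows "psi k \<alpha> = psi k \<beta> \<longleftrightarrow> (\<exists>n::int. \<alpha> = \<beta> + of_int n * pi)"
proof
  assume "psi k \<alpha> = psi k \<beta>"
  \<comment> \<open>A translation is determined by one value: since \<open>ell k 0 = 0\<close>, the
    image of the point 1 under \<open>psi k \<alpha>\<close> is
    \<open>cis (2 * \<alpha>)\<close>.\<close>
  then have "psi k \<alpha> (cis (2 * 0)) = psi k \<beta> (cis (2 * 0))" by simp
  then show "\<exists>n::int. \<alpha> = \<beta> + of_int n * pi"
    unfolding psi_cis[OF assms] by (simp add: assms cis_double_eq_iff)
next
  assume "\<exists>n::int. \<alpha> = \<beta> + of_int n * pi"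
  then obtain n :: int where n: "\<alpha> = \<beta> + of_int n * pi" ..
  have "am k (ell k \<theta> + ell k \<alpha>) = am k (ell k \<theta> + ell k \<beta>) + of_int n * pi" for \<theta>
    \<comment> \<open>Applying the injective \<open>ell k\<close> to both sides removes
      \<open>am k\<close> and leaves an identity between sums.\<close>
    by (subst ell_eq_iff[OF assms, symmetric]) (simp add: n ell_add_int_pi assms)
  then have "cis (2 * am k (ell k \<theta> + ell k \<alpha>)) = cis (2 * am k (ell k \<theta> + ell k \<beta>))" for \<theta>
    unfolding cis_double_eq_iff by blast
  then show "psi k \<alpha> = psi k \<beta>"
    by (intro extensional_unit_circle_eqI) (simp_all add: psi_extensional psi_cis assms)
qed

text \<open>The two endpoints differ by one period \<open>pi\<close>. Together with
  \<open>psi_inv\<close> this makes \<open>psi k (pi / 2)\<close> its own inverse.\<close>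

lemma psi_minus_half_pi:
  assumes "0 < k" "k < 1"
  shows "psi k (- (pi / 2)) = psi k (pi / 2)"
  unfolding psi_eq_iff[OF assms] by (rule exI[of _ "-1"]) simp

text \<open>The half-open interval has length \<open>pi\<close>, so it is a fundamental domain for
  the shifts that leave \<open>psi k\<close> unchanged. Products and inverses then need no reduction
  of their indices.\<close>

lemma psi_maps_eq_range:
  assumes "0 < k" "k < 1"
  shows "psi_maps k = range (psi k)"
proof -
  have "psi k \<alpha> \<in> psi_maps k" for \<alpha>
  proof -
    \<comment> \<open>Ceiling rather than floor, because the interval is closed on the
      right.\<close>
    define n where "n = \<lceil>\<alpha> / pi - 1 / 2\<rceil>"
    have "\<alpha> / pi - 1 / 2 \<le> of_int n" "of_int n < \<alpha> / pi - 1 / 2 + 1"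
      unfolding n_def by linarith+
    then have "\<alpha> - of_int n * pi \<in> {- pi / 2 <.. pi / 2}"
      by (simp add: field_simps)
    moreover have "psi k \<alpha> = psi k (\<alpha> - of_int n * pi)"
      unfolding psi_eq_iff[OF assms] by (rule exI[of _ n]) simp
    ultimately show ?thesis unfolding psi_maps_def by blast
  qed
  then show ?thesis unfolding psi_maps_def by auto
qed

lemma psi_in_carrier:
  assumes "0 < k" "k < 1"
  shows "psi k \<alpha> \<in> carrier (psi_group k)"
  by (simp add: psi_group_def psi_maps_eq_range assms)

lemma psi_mult:
  assumes "0 < k" "k < 1"
  shows "psi k \<alpha> \<otimes>\<^bsub>psi_group k\<^esub> psi k \<beta> = psi k (am k (ell k \<alpha> + ell k \<beta>))"
  by (simp add: psi_group_def compose_psi assms)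

lemma psi_one:
  assumes "0 < k" "k < 1"
  shows "\<one>\<^bsub>psi_group k\<^esub> = psi k 0"
  by (simp add: psi_group_def psi_0 assms)

lemma psi_minus_mult:
  assumes "0 < k" "k < 1"
  shows "psi k (- \<alpha>) \<otimes>\<^bsub>psi_group k\<^esub> psi k \<alpha> = \<one>\<^bsub>psi_group k\<^esub>"
  \<comment> \<open>The index of the product is \<open>am k 0\<close>, which is \<open>0\<close>
    because \<open>ell k 0 = 0\<close>.\<close>
  using am_ell[OF assms, of 0] by (simp add: psi_mult psi_one ell_minus assms)

text \<open>Once every element is written as \<open>psi k \<alpha>\<close>, \<open>psi_mult\<close>
  turns the group laws into those of real addition.\<close>

lemma psi_comm_group:
  assumes "0 < k" "k < 1"
  shows "comm_group (psi_group k)"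
proof (rule comm_groupI)
  have cases: "\<exists>\<alpha>. f = psi k \<alpha>" if "f \<in> carrier (psi_group k)" for f
    using that by (auto simp: psi_group_def psi_maps_eq_range[OF assms])
  let ?G = "psi_group k"
  show "\<one>\<^bsub>?G\<^esub> \<in> carrier ?G" by (simp add: psi_one psi_in_carrier assms)
  fix x assume "x \<in> carrier ?G"
  then obtain \<alpha> where x: "x = psi k \<alpha>" using cases by blast
  show "\<one>\<^bsub>?G\<^esub> \<otimes>\<^bsub>?G\<^esub> x = x" by (simp add: x psi_one psi_mult assms)
  show "\<exists>y\<in>carrier ?G. y \<otimes>\<^bsub>?G\<^esub> x = \<one>\<^bsub>?G\<^esub>"
    unfolding x using psi_minus_mult[OF assms] psi_in_carrier[OF assms] by blast
  fix y assume "y \<in> carrier ?G"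
  then obtain \<beta> where y: "y = psi k \<beta>" using cases by blast
  show "x \<otimes>\<^bsub>?G\<^esub> y \<in> carrier ?G" by (simp add: x y psi_mult psi_in_carrier assms)
  show "x \<otimes>\<^bsub>?G\<^esub> y = y \<otimes>\<^bsub>?G\<^esub> x" by (simp add: x y psi_mult assms add.commute)
  fix z assume "z \<in> carrier ?G"
  then obtain \<gamma> where z: "z = psi k \<gamma>" using cases by blast
  show "x \<otimes>\<^bsub>?G\<^esub> y \<otimes>\<^bsub>?G\<^esub> z = x \<otimes>\<^bsub>?G\<^esub> (y \<otimes>\<^bsub>?G\<^esub> z)"
    by (simp add: x y z psi_mult assms add.assoc)
qed

lemma psi_inv:
  assumes "0 < k" "k < 1"
  shows "inv\<^bsub>psi_group k\<^esub> (psi k \<alpha>) = psi k (- \<alpha>)"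
proof -
  interpret comm_group "psi_group k" by (rule psi_comm_group[OF assms])
  show ?thesis
    by (rule inv_equality) (simp_all add: psi_minus_mult psi_in_carrier assms)
qed

text \<open>The square of \<open>psi k \<alpha>\<close> is the translation by
  \<open>2 * ell k \<alpha>\<close>, which is trivial exactly when this is an integer multiple of
  the period \<open>ell k pi\<close>.\<close>

lemma psi_involution_iff:
  assumes "0 < k" "k < 1"
  shows "(\<forall>z\<in>unit_circle. psi k \<alpha> (psi k \<alpha> z) = z) \<longleftrightarrow> (\<exists>n::int. \<alpha> = of_int n * (pi / 2))"
proof -
  have "(\<forall>z\<in>unit_circle. psi k \<alpha> (psi k \<alpha> z) = z)
      \<longleftrightarrow> compose unit_circle (psi k \<alpha>) (psi k \<alpha>) = psi k 0"
    unfolding psi_0[OF assms] fun_eq_iff compose_def by (auto simp: restrict_def)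
  also have "\<dots> \<longleftrightarrow> (\<exists>n::int. am k (ell k \<alpha> + ell k \<alpha>) = of_int n * pi)"
    by (simp add: compose_psi psi_eq_iff assms)
  also have "\<dots> \<longleftrightarrow> (\<exists>n::int. 2 * ell k \<alpha> = of_int n * ell k pi)"
    by (subst ell_eq_iff[OF assms, symmetric]) (simp add: ell_int_pi assms)
  also have "\<dots> \<longleftrightarrow> (\<exists>n::int. \<alpha> = of_int n * (pi / 2))"
    \<comment> \<open>Each multiple of the period is rewritten as twice a value of
      \<open>ell k\<close>, so that injectivity applies.\<close>
    by (simp add: ell_int_half_pi[OF assms, symmetric] ell_eq_iff assms)
  finally show ?thesis .
qed

theorem theorem3:
  fixes k :: real
  assumes "0 < k" and "k < 1"
  shows "comm_group (psi_group k) \<and>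
    \<one>\<^bsub>psi_group k\<^esub> = psi k 0 \<and>
    (\<forall>\<alpha>\<in>{- pi / 2 <.. pi / 2}. inv\<^bsub>psi_group k\<^esub> (psi k \<alpha>) = psi k (- \<alpha>)) \<and>
    inv\<^bsub>psi_group k\<^esub> (psi k (pi / 2)) = psi k (pi / 2) \<and>
    {f \<in> psi_maps k. f \<noteq> (\<lambda>z\<in>unit_circle. z) \<and> (\<forall>z\<in>unit_circle. f (f z) = z)} = {psi k (pi / 2)}"
proof (intro conjI ballI)
  show "comm_group (psi_group k)" by (rule psi_comm_group[OF assms])
  show "\<one>\<^bsub>psi_group k\<^esub> = psi k 0" by (rule psi_one[OF assms])
  show "inv\<^bsub>psi_group k\<^esub> (psi k \<alpha>) = psi k (- \<alpha>)" for \<alpha>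
    by (rule psi_inv[OF assms])
  show "inv\<^bsub>psi_group k\<^esub> (psi k (pi / 2)) = psi k (pi / 2)"
    by (simp add: psi_inv psi_minus_half_pi assms)
  have half_ne_0: "psi k (pi / 2) \<noteq> psi k 0"
  proof
    assume "psi k (pi / 2) = psi k 0"
    then obtain n :: int where "pi / 2 = of_int n * pi"
      by (auto simp: psi_eq_iff[OF assms])
    \<comment> \<open>Cancelling \<open>pi\<close> leaves a parity contradiction over the
      integers.\<close>
    then have "of_int (2 * n) = (of_int 1 :: real)" by (simp add: field_simps)
    then have "2 * n = 1" by (simp only: of_int_eq_iff)
    then show False by presburger
  qed
  have unique: "psi k \<alpha> = psi k (pi / 2)"
    if range: "\<alpha> \<in> {- pi / 2 <.. pi / 2}" and ne: "psi k \<alpha> \<noteq> psi k 0"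
      and inv: "\<forall>z\<in>unit_circle. psi k \<alpha> (psi k \<alpha> z) = z" for \<alpha>
  proof -
    obtain n :: int where n: "\<alpha> = of_int n * (pi / 2)"
      using inv unfolding psi_involution_iff[OF assms] ..
    \<comment> \<open>Both bounds are written as multiples of \<open>pi / 2\<close> so that this
      factor cancels. The strict left bound excludes n = -1, and n = 0 gives the identity.\<close>
    have "(- 1) * (pi / 2) < of_int n * (pi / 2)" "of_int n * (pi / 2) \<le> 1 * (pi / 2)"
      using range by (simp_all add: n)
    then have "- 1 < (of_int n :: real)" "(of_int n :: real) \<le> 1"
      by (simp_all only: mult_less_cancel_right_pos mult_le_cancel_right_pos pi_half_gt_zero)
    then have "n = 0 \<or> n = 1" by linarith
    then have "\<alpha> = 0 \<or> \<alpha> = pi / 2" using n by fastforce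
    then show ?thesis using ne by blast
  qed
  have half_in: "psi k (pi / 2) \<in> psi_maps k"
    by (simp add: psi_maps_eq_range assms)
  have half_involution: "\<forall>z\<in>unit_circle. psi k (pi / 2) (psi k (pi / 2) z) = z"
    unfolding psi_involution_iff[OF assms] by (rule exI[of _ 1]) simp
  show "{f \<in> psi_maps k. f \<noteq> (\<lambda>z\<in>unit_circle. z) \<and> (\<forall>z\<in>unit_circle. f (f z) = z)} = {psi k (pi / 2)}"
    unfolding psi_0[OF assms, symmetric]
  proof (intro equalityI subsetI)
    fix f assume "f \<in> {f \<in> psi_maps k. f \<noteq> psi k 0 \<and> (\<forall>z\<in>unit_circle. f (f z) = z)}"
    then show "f \<in> {psi k (pi / 2)}"
      unfolding psi_maps_def using unique by blast
  qed (use half_in half_ne_0 half_involution in auto)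
qed

end
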